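(* $\mathbf{mCi}$ is axiomatizable by a finite and analytic two-dimensional H-system: there is a Set$^2$-Set$^2$ H-system $\mathsf{R}$ with finitely many rule schemas which is $\Theta$-analytic for some finite set $\Theta\supseteq\{p\}$ of unary formulas and whose $t$-aspect coincides with the one-dimensional consequence relation $\vDash_{\mathbb{M}_{\mathbf{mCi}}}$ (i.e. for all sets of formulas $\Phi,\Psi$: the $\mathcal{B}$-statement with antecedent $(\Phi,\varnothing)$ and succedent $(\Psi,\varnothing)$ is provable in $\mathsf{R}$ iff $\Phi\vDash_{\mathbb{M}_{\mathbf{mCi}}}\Psi$).
   Context: Let $\Sigma$ be the signature with unary connectives $\neg,\circ$ and binary $\land,\lor,\to$, over a denumerable set of variables. The nd-matrix $\mathbb{M}_{\mathbf{mCi}}$ has carrier $\{f,F,I,T,t\}$, designated set $D=\{I,T,t\}$ and multi-operations: $x_1\land x_2=\{f\}$ if $x_1\notin D$ or $x_2\notin D$, else $\{I,t\}$; $x_1\lor x_2=\{I,t\}$ if $x_1\in D$ or $x_2\in D$, else $\{f\}$; $x_1\to x_2=\{I,t\}$ if $x_1\notin D$ or $x_2\in D$, else $\{f\}$; $\neg f=\{I,t\}$, $\neg F=\{T\}$, $\neg I=\{I,t\}$, $\neg T=\{F\}$, $\neg t=\{f\}$; $\circ I=\{F\}$ and $\circ x=\{T\}$ for $x\ne I$. A valuation is a map $v$ from formulas to the carrier with $v(©(\varphi_1,\ldots,\varphi_k))\in ©(v(\varphi_1),\ldots,v(\varphi_k))$. $\Phi\vDash_{\mathbb{M}_{\mathbf{mCi}}}\Psi$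 iff every valuation sends some member of $\Phi$ outside $D$ or some member of $\Psi$ into $D$; this is the one-dimensional logic $\mathbf{mCi}$ (its restriction to single conclusions is the consequence relation of the Hilbert calculus obtained from positive classical logic by adding the axioms $p\lor\neg p$, $\circ p\to(p\to(\neg p\to q))$, $\neg\circ p\to(p\land\neg p)$ and $\circ\neg^j\circ p$ for all $j\in\omega$). A Set$^2$-Set$^2$ H-system is a set of rule schemas, each consisting of an antecedent pair $(\Delta_1,\Delta_2)$ and a succedent pair $(\Pi_1,\Pi_2)$ of finite sets of formulas; its instances are images under substitutions. A derivation is a finite rooted tree with nodes labelled by pairs $(\Gamma_1,\Gamma_2)$ or by $*$; a non-leaf node $(\Gamma_1,\Gamma_2)$ is expanded by an instance with $\Delta_1\subseteq\Gamma_1$, $\Delta_2\subseteq\Gamma_2$: it gets one child $(\Gamma_1\cup\{\psi\},\Gamma_2)$ per $\psi\in\Pi_1$ and one child $(\Gamma_1,\Gamma_2\cup\{\psi\})$ per $\psi\in\Pi_2$, or a single child $*$ if $\Pi_1=\Pi_2=\varnothing$. A proof of the statement with antecedent $(\Phi_1,\Phi_2)$ and succedent $(\Psi_1,\Psi_2)$ is a derivation whose root label is componentwise contained in $(\Phi_1,\Phi_2)$ and each of whose leaves is $*$ or a pair $(\Gamma_1,\Gamma_2)$ with $\Gamma_1\cap\Psi_1\ne\varnothing$ or $\Gamma_2\cap\Psi_2\ne\varnothing$. The $t$-aspect of the system is the relation $\Phi\rhd^t\Psi$ iff the statement with antecedent $(\Phi,\varnothing)$ and succedent $(\Psi,\varnothing)$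 has a proof. For a set $\Theta$ of formulas in the single variable $p$, the $\Theta$-subformulas of a set $\Xi$ are all $\sigma(\theta)$ with $\theta\in\Theta$ and $\sigma$ mapping variables into subformulas of members of $\Xi$; the system is $\Theta$-analytic if every provable statement has a proof all of whose labels consist only of $\Theta$-subformulas of formulas occurring in the statement. *)

theory Defs imports Main begin

datatype fm =
    Var nat
  | Neg fm
  | Circ fm
  | Conj fm fm
  | Disj fm fm
  | Imp fm fm

abbreviation p :: fm where "p \<equiv> Var 0"

primrec vars :: "fm \<Rightarrow> nat set" where
  "vars (Var n) = {n}"
| "vars (Neg a) = vars a"
| "vars (Circ a) = vars a"
| "vars (Conj a b) = vars a \<union> vars b"
| "vars (Disj a b) = vars a \<union> vars b"
| "vars (Imp a b) = vars a \<union> vars b"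

primrec subst :: "(nat \<Rightarrow> fm) \<Rightarrow> fm \<Rightarrow> fm" where
  "subst s (Var n) = s n"
| "subst s (Neg a) = Neg (subst s a)"
| "subst s (Circ a) = Circ (subst s a)"
| "subst s (Conj a b) = Conj (subst s a) (subst s b)"
| "subst s (Disj a b) = Disj (subst s a) (subst s b)"
| "subst s (Imp a b) = Imp (subst s a) (subst s b)"

primrec subformulas :: "fm \<Rightarrow> fm set" where
  "subformulas (Var n) = {Var n}"
| "subformulas (Neg a) = insert (Neg a) (subformulas a)"
| "subformulas (Circ a) = insert (Circ a) (subformulas a)"
| "subformulas (Conj a b) = insert (Conj a b) (subformulas a \<union> subformulas b)"
| "subformulas (Disj a b) = insert (Disj a b) (subformulas a \<union> subformulas b)"
| "subformulas (Imp a b) = insert (Imp a b) (subformulas a \<union> subformulas b)"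


section \<open>Non-deterministic matrices\<close>

text \<open>The carrier of a matrix is the type of its truth values.\<close>

record 'v nd_matrix =
  designated :: "'v set"
  neg_op  :: "'v \<Rightarrow> 'v set"
  circ_op :: "'v \<Rightarrow> 'v set"
  conj_op :: "'v \<Rightarrow> 'v \<Rightarrow> 'v set"
  disj_op :: "'v \<Rightarrow> 'v \<Rightarrow> 'v set"
  imp_op  :: "'v \<Rightarrow> 'v \<Rightarrow> 'v set"

definition valuation :: "'v nd_matrix \<Rightarrow> (fm \<Rightarrow> 'v) \<Rightarrow> bool" where
  "valuation M v \<longleftrightarrow>
     (\<forall>a. v (Neg a) \<in> neg_op M (v a)) \<and>
     (\<forall>a. v (Circ a) \<in> circ_op M (v a)) \<and>
     (\<forall>a b. v (Conj a b) \<in> conj_op M (v a) (v b)) \<and>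
     (\<forall>a b. v (Disj a b) \<in> disj_op M (v a) (v b)) \<and>
     (\<forall>a b. v (Imp a b) \<in> imp_op M (v a) (v b))"

definition entails :: "'v nd_matrix \<Rightarrow> fm set \<Rightarrow> fm set \<Rightarrow> bool" where
  "entails M \<Phi> \<Psi> \<longleftrightarrow>
     (\<forall>v. valuation M v \<longrightarrow>
        (\<exists>a\<in>\<Phi>. v a \<notin> designated M) \<or> (\<exists>b\<in>\<Psi>. v b \<in> designated M))"

text \<open>The values \<open>f\<close>, \<open>F\<close>, \<open>I\<close>, \<open>T\<close>, \<open>t\<close> carry the prefix \<open>V\<close>.\<close>

datatype val = Vf | VF | VI | VT | Vt

definition D_mCi :: "val set" where
  "D_mCi = {VI, VT, Vt}"

primrec neg_mCi :: "val \<Rightarrow> val set" where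
  "neg_mCi Vf = {VI, Vt}"
| "neg_mCi VF = {VT}"
| "neg_mCi VI = {VI, Vt}"
| "neg_mCi VT = {VF}"
| "neg_mCi Vt = {Vf}"

definition M_mCi :: "val nd_matrix" where
  "M_mCi = \<lparr>
     designated = D_mCi,
     neg_op = neg_mCi,
     circ_op = (\<lambda>x. if x = VI then {VF} else {VT}),
     conj_op = (\<lambda>x y. if x \<notin> D_mCi \<or> y \<notin> D_mCi then {Vf} else {VI, Vt}),
     disj_op = (\<lambda>x y. if x \<in> D_mCi \<or> y \<in> D_mCi then {VI, Vt} else {Vf}),
     imp_op = (\<lambda>x y. if x \<notin> D_mCi \<or> y \<in> D_mCi then {VI, Vt} else {Vf}) \<rparr>"


section \<open>Two-dimensional H-systems\<close>

text \<open>A two-dimensional statement is an antecedent pair together with a succedent pair of sets of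
  formulas; a rule schema is such a statement all of whose components are finite.\<close>

type_synonym bset = "fm set \<times> fm set"
type_synonym bstatement = "bset \<times> bset"

fun formulas_of :: "bstatement \<Rightarrow> fm set" where
  "formulas_of ((\<Phi>1, \<Phi>2), (\<Psi>1, \<Psi>2)) = \<Phi>1 \<union> \<Phi>2 \<union> \<Psi>1 \<union> \<Psi>2"

definition h_system :: "bstatement set \<Rightarrow> bool" where
  "h_system R \<longleftrightarrow> (\<forall>r\<in>R. finite (formulas_of r))"

fun subst_statement :: "(nat \<Rightarrow> fm) \<Rightarrow> bstatement \<Rightarrow> bstatement" where
  "subst_statement s ((\<Delta>1, \<Delta>2), (\<Pi>1, \<Pi>2)) =
     ((subst s ` \<Delta>1, subst s ` \<Delta>2), (subst s ` \<Pi>1, subst s ` \<Pi>2))"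

definition rule_instances :: "bstatement set \<Rightarrow> bstatement set" where
  "rule_instances R = {subst_statement s r | s r. r \<in> R}"

datatype label = Star | Pair "fm set" "fm set"

datatype (labels: 'l) tree = Tree (root: 'l) "'l tree list"

primrec leaf_labels :: "'l tree \<Rightarrow> 'l set" where
  "leaf_labels (Tree l ts) = (if ts = [] then {l} else \<Union> (set (map leaf_labels ts)))"

text \<open>The children of a node are kept in a list, those for \<open>\<Pi>1\<close> first.  The lists \<open>xs\<close> and \<open>ys\<close>
  enumerate \<open>\<Pi>1\<close> and \<open>\<Pi>2\<close> without repetition, so that there is exactly one child per formula,
  even if several children carry the same label.\<close>

definition child_labels :: "bset \<Rightarrow> bset \<Rightarrow> label list \<Rightarrow> bool" where
  "child_labels \<Gamma> \<Pi> ls \<longleftrightarrow>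
     (if fst \<Pi> = {} \<and> snd \<Pi> = {} then ls = [Star]
      else \<exists>xs ys. distinct xs \<and> set xs = fst \<Pi> \<and> distinct ys \<and> set ys = snd \<Pi> \<and>
             ls = map (\<lambda>a. Pair (insert a (fst \<Gamma>)) (snd \<Gamma>)) xs
                  @ map (\<lambda>a. Pair (fst \<Gamma>) (insert a (snd \<Gamma>))) ys)"

inductive derivation :: "bstatement set \<Rightarrow> label tree \<Rightarrow> bool" for R where
  leaf: "derivation R (Tree l [])"
| expand:
    "\<lbrakk>((\<Delta>1, \<Delta>2), \<Pi>) \<in> rule_instances R; \<Delta>1 \<subseteq> \<Gamma>1; \<Delta>2 \<subseteq> \<Gamma>2;
      child_labels (\<Gamma>1, \<Gamma>2) \<Pi> (map root ts); \<forall>t\<in>set ts. derivation R t\<rbrakk>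
     \<Longrightarrow> derivation R (Tree (Pair \<Gamma>1 \<Gamma>2) ts)"

fun is_proof :: "bstatement set \<Rightarrow> bstatement \<Rightarrow> label tree \<Rightarrow> bool" where
  "is_proof R ((\<Phi>1, \<Phi>2), (\<Psi>1, \<Psi>2)) t \<longleftrightarrow>
     derivation R t \<and>
     (\<exists>\<Gamma>1 \<Gamma>2. root t = Pair \<Gamma>1 \<Gamma>2 \<and> \<Gamma>1 \<subseteq> \<Phi>1 \<and> \<Gamma>2 \<subseteq> \<Phi>2) \<and>
     (\<forall>l\<in>leaf_labels t.
        l = Star \<or> (\<exists>\<Gamma>1 \<Gamma>2. l = Pair \<Gamma>1 \<Gamma>2 \<and> (\<Gamma>1 \<inter> \<Psi>1 \<noteq> {} \<or> \<Gamma>2 \<inter> \<Psi>2 \<noteq> {})))"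

definition provable :: "bstatement set \<Rightarrow> bstatement \<Rightarrow> bool" where
  "provable R S \<longleftrightarrow> (\<exists>t. is_proof R S t)"

definition t_aspect :: "bstatement set \<Rightarrow> fm set \<Rightarrow> fm set \<Rightarrow> bool" where
  "t_aspect R \<Phi> \<Psi> \<longleftrightarrow> provable R ((\<Phi>, {}), (\<Psi>, {}))"

definition gen_subformulas :: "fm set \<Rightarrow> fm set \<Rightarrow> fm set" where
  "gen_subformulas \<Theta> \<Xi> =
     {subst s \<theta> | s \<theta>. \<theta> \<in> \<Theta> \<and> (\<forall>n. s n \<in> (\<Union>a\<in>\<Xi>. subformulas a))}"

primrec label_formulas :: "label \<Rightarrow> fm set" where
  "label_formulas Star = {}"
| "label_formulas (Pair \<Gamma>1 \<Gamma>2) = \<Gamma>1 \<union> \<Gamma>2"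

definition analytic :: "fm set \<Rightarrow> bstatement set \<Rightarrow> bool" where
  "analytic \<Theta> R \<longleftrightarrow>
     (\<forall>S. provable R S \<longrightarrow>
        (\<exists>t. is_proof R S t \<and>
             (\<forall>l\<in>labels t. label_formulas l \<subseteq> gen_subformulas \<Theta> (formulas_of S))))"

end

theory Submission imports Defs begin

text \<open>The second dimension is read as membership in \<open>{F, T}\<close>. Together with the designated
  set it separates all values except \<open>I\<close> and \<open>t\<close>, and these two are told apart by whether
  \<open>\<not>a\<close> is designated. Hence the value of \<open>a\<close> is determined by which of \<open>a\<close>, \<open>\<not>a\<close> are accepted
  in which dimension, every entry of the multi-operations becomes a rule about subformulas and
  their negations, and a set of signed formulas maximal among those from which the succedent is
  not derivable within the generalized subformulas already yields a countermodel.\<close>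

section \<open>Soundness of proof trees for arbitrary pairs of accepted sets\<close>

text \<open>\<open>G1\<close> and \<open>G2\<close> collect the formulas accepted in each dimension.
  They come from a valuation in the soundness argument and from a maximal underivable pair in the
  completeness argument.\<close>

fun obeys :: "fm set \<Rightarrow> fm set \<Rightarrow> bstatement \<Rightarrow> bool" where
  "obeys G1 G2 ((\<Delta>1, \<Delta>2), (\<Pi>1, \<Pi>2)) \<longleftrightarrow>
     (\<Delta>1 \<subseteq> G1 \<and> \<Delta>2 \<subseteq> G2 \<longrightarrow> \<Pi>1 \<inter> G1 \<noteq> {} \<or> \<Pi>2 \<inter> G2 \<noteq> {})"

text \<open>At each expansion some succedent formula of the instance is accepted, so one can descend
  to the child that adds it and stay inside (\<open>G1\<close>, \<open>G2\<close>) down to a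
  leaf.\<close>

lemma derivation_sound:
  assumes "derivation R t"
    and "\<And>r. r \<in> rule_instances R \<Longrightarrow> obeys G1 G2 r"
    and "root t = Pair \<Gamma>1 \<Gamma>2" "\<Gamma>1 \<subseteq> G1" "\<Gamma>2 \<subseteq> G2"
  shows "\<exists>\<Gamma>1' \<Gamma>2'. Pair \<Gamma>1' \<Gamma>2' \<in> leaf_labels t \<and> \<Gamma>1' \<subseteq> G1 \<and> \<Gamma>2' \<subseteq> G2"
  using assms(1,3,4,5)
proof (induction arbitrary: \<Gamma>1 \<Gamma>2)
  case (leaf l)
  then show ?case by auto
next
  case (expand \<Delta>1 \<Delta>2 \<Pi> A1 A2 ts)
  have eq: "A1 = \<Gamma>1" "A2 = \<Gamma>2" using expand.prems(1) by auto
  obtain \<Pi>1 \<Pi>2 where \<Pi>: "\<Pi> = (\<Pi>1, \<Pi>2)" by force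
  have "obeys G1 G2 ((\<Delta>1, \<Delta>2), (\<Pi>1, \<Pi>2))"
    using assms(2) expand.hyps(1) \<Pi> by blast
  \<comment> \<open>An instance with empty succedent cannot apply inside (\<open>G1\<close>,
    \<open>G2\<close>), which excludes the \<open>Star\<close> child.\<close>
  then have hit: "\<Pi>1 \<inter> G1 \<noteq> {} \<or> \<Pi>2 \<inter> G2 \<noteq> {}"
    using expand.hyps expand.prems eq by auto
  then obtain xs ys where "set xs = \<Pi>1" "set ys = \<Pi>2"
    "map root ts = map (\<lambda>a. Pair (insert a A1) A2) xs @ map (\<lambda>a. Pair A1 (insert a A2)) ys"
    using expand.hyps(4) \<Pi> unfolding child_labels_def by (auto split: if_splits)
  then have roots: "root ` set ts =
      (\<lambda>a. Pair (insert a A1) A2) ` \<Pi>1 \<union> (\<lambda>a. Pair A1 (insert a A2)) ` \<Pi>2"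
    by (metis list.set_map set_append)
  obtain l B1 B2 where "l \<in> root ` set ts" "l = Pair B1 B2" "B1 \<subseteq> G1" "B2 \<subseteq> G2"
    using hit
  proof
    assume "\<Pi>1 \<inter> G1 \<noteq> {}"
    then obtain a where "a \<in> \<Pi>1" "a \<in> G1" by blast
    then show thesis
      using that[of "Pair (insert a A1) A2" "insert a A1" A2] roots expand.prems eq by blast
  next
    assume "\<Pi>2 \<inter> G2 \<noteq> {}"
    then obtain a where "a \<in> \<Pi>2" "a \<in> G2" by blast
    then show thesis
      using that[of "Pair A1 (insert a A2)" A1 "insert a A2"] roots expand.prems eq by blast
  qed
  then obtain t where t: "t \<in> set ts" "root t = Pair B1 B2" by auto
  then obtain C1 C2 where "Pair C1 C2 \<in> leaf_labels t" "C1 \<subseteq> G1" "C2 \<subseteq> G2"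
    using expand.IH \<open>B1 \<subseteq> G1\<close> \<open>B2 \<subseteq> G2\<close> by blast
  moreover have "ts \<noteq> []" using t by auto
  ultimately show ?case using t by auto
qed

lemma provable_sound:
  assumes "provable R S" and "\<And>r. r \<in> rule_instances R \<Longrightarrow> obeys G1 G2 r"
  shows "obeys G1 G2 S"
proof -
  obtain \<Phi>1 \<Phi>2 \<Psi>1 \<Psi>2 where S: "S = ((\<Phi>1, \<Phi>2), (\<Psi>1, \<Psi>2))" by (metis surj_pair)
  obtain t \<Gamma>1 \<Gamma>2 where t: "derivation R t" "root t = Pair \<Gamma>1 \<Gamma>2" "\<Gamma>1 \<subseteq> \<Phi>1" "\<Gamma>2 \<subseteq> \<Phi>2"
    and leaves: "\<forall>l\<in>leaf_labels t. l = Star \<or>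
      (\<exists>\<Gamma>1 \<Gamma>2. l = Pair \<Gamma>1 \<Gamma>2 \<and> (\<Gamma>1 \<inter> \<Psi>1 \<noteq> {} \<or> \<Gamma>2 \<inter> \<Psi>2 \<noteq> {}))"
    using assms(1) unfolding provable_def S by auto
  have "\<Psi>1 \<inter> G1 \<noteq> {} \<or> \<Psi>2 \<inter> G2 \<noteq> {}" if sub: "\<Phi>1 \<subseteq> G1" "\<Phi>2 \<subseteq> G2"
  proof -
    have "\<Gamma>1 \<subseteq> G1" "\<Gamma>2 \<subseteq> G2" using sub t by auto
    then obtain C1 C2 where C: "Pair C1 C2 \<in> leaf_labels t" "C1 \<subseteq> G1" "C2 \<subseteq> G2"
      using derivation_sound[OF t(1) assms(2) t(2)] by blast
    then have "C1 \<inter> \<Psi>1 \<noteq> {} \<or> C2 \<inter> \<Psi>2 \<noteq> {}" using leaves by fastforce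
    then show ?thesis using C by blast
  qed
  then show ?thesis using S by simp
qed

section \<open>Tree-free derivability, compactness and saturation\<close>

text \<open>Derivability within \<open>\<Lambda>\<close> without trees; unlike proof trees, it is manifestly closed under
  enlarging the root.\<close>

inductive derives :: "bstatement set \<Rightarrow> fm set \<Rightarrow> fm set \<Rightarrow> fm set \<Rightarrow> fm set \<Rightarrow> fm set \<Rightarrow> bool"
  for R \<Lambda> \<Psi>1 \<Psi>2 where
  hit: "\<Gamma>1 \<inter> \<Psi>1 \<noteq> {} \<or> \<Gamma>2 \<inter> \<Psi>2 \<noteq> {} \<Longrightarrow> derives R \<Lambda> \<Psi>1 \<Psi>2 \<Gamma>1 \<Gamma>2"
| step: "\<lbrakk>((\<Delta>1, \<Delta>2), (\<Pi>1, \<Pi>2)) \<in> rule_instances R; \<Pi>1 \<union> \<Pi>2 \<subseteq> \<Lambda>;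
      \<Delta>1 \<subseteq> \<Gamma>1; \<Delta>2 \<subseteq> \<Gamma>2;
      \<And>a. a \<in> \<Pi>1 \<Longrightarrow> derives R \<Lambda> \<Psi>1 \<Psi>2 (insert a \<Gamma>1) \<Gamma>2;
      \<And>a. a \<in> \<Pi>2 \<Longrightarrow> derives R \<Lambda> \<Psi>1 \<Psi>2 \<Gamma>1 (insert a \<Gamma>2)\<rbrakk>
     \<Longrightarrow> derives R \<Lambda> \<Psi>1 \<Psi>2 \<Gamma>1 \<Gamma>2"

lemma derives_mono:
  assumes "derives R \<Lambda> \<Psi>1 \<Psi>2 \<Gamma>1 \<Gamma>2" "\<Gamma>1 \<subseteq> \<Gamma>1'" "\<Gamma>2 \<subseteq> \<Gamma>2'"
  shows "derives R \<Lambda> \<Psi>1 \<Psi>2 \<Gamma>1' \<Gamma>2'"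
  using assms
proof (induction arbitrary: \<Gamma>1' \<Gamma>2')
  case (hit \<Gamma>1 \<Gamma>2)
  then show ?case by (intro derives.hit) blast
next
  case (step \<Delta>1 \<Delta>2 \<Pi>1 \<Pi>2 \<Gamma>1 \<Gamma>2)
  show ?case
    using step.hyps(1,2)
  proof (rule derives.step)
    show "derives R \<Lambda> \<Psi>1 \<Psi>2 (insert a \<Gamma>1') \<Gamma>2'" if "a \<in> \<Pi>1" for a
      by (rule step.IH(1)[OF that]) (use step.prems in auto)
    show "derives R \<Lambda> \<Psi>1 \<Psi>2 \<Gamma>1' (insert a \<Gamma>2')" if "a \<in> \<Pi>2" for a
      by (rule step.IH(2)[OF that]) (use step.prems in auto)
  qed (use step in auto)
qed

lemma finite_rule_instance:
  assumes "h_system R" "((\<Delta>1, \<Delta>2), (\<Pi>1, \<Pi>2)) \<in> rule_instances R"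
  shows "finite \<Delta>1" "finite \<Delta>2" "finite \<Pi>1" "finite \<Pi>2"
proof -
  obtain s r where r: "r \<in> R" "((\<Delta>1, \<Delta>2), (\<Pi>1, \<Pi>2)) = subst_statement s r"
    using assms(2) unfolding rule_instances_def by blast
  moreover obtain A1 A2 B1 B2 where "r = ((A1, A2), (B1, B2))" by (metis surj_pair)
  moreover have "finite (formulas_of r)"
    using assms(1) r(1) unfolding h_system_def by blast
  ultimately show "finite \<Delta>1" "finite \<Delta>2" "finite \<Pi>1" "finite \<Pi>2" by auto
qed

text \<open>Compactness: a rule instance has finitely many premises and a finite antecedent, so
  finite supports of the premises combine into a finite support of the conclusion. This makes the
  chain condition of Zorn's lemma hold.\<close>

lemma derives_finite:
  assumes "h_system R" "derives R \<Lambda> \<Psi>1 \<Psi>2 \<Gamma>1 \<Gamma>2"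
  shows "\<exists>F1 F2. finite F1 \<and> finite F2 \<and> F1 \<subseteq> \<Gamma>1 \<and> F2 \<subseteq> \<Gamma>2 \<and> derives R \<Lambda> \<Psi>1 \<Psi>2 F1 F2"
  using assms(2)
proof induction
  case (hit \<Gamma>1 \<Gamma>2)
  then show ?case
  proof
    assume "\<Gamma>1 \<inter> \<Psi>1 \<noteq> {}"
    then obtain a where "a \<in> \<Gamma>1" "a \<in> \<Psi>1" by blast
    then show ?thesis
      by (intro exI[of _ "{a}"] exI[of _ "{}"]) (auto intro: derives.hit)
  next
    assume "\<Gamma>2 \<inter> \<Psi>2 \<noteq> {}"
    then obtain a where "a \<in> \<Gamma>2" "a \<in> \<Psi>2" by blast
    then show ?thesis
      by (intro exI[of _ "{}"] exI[of _ "{a}"]) (auto intro: derives.hit)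
  qed
next
  case (step \<Delta>1 \<Delta>2 \<Pi>1 \<Pi>2 \<Gamma>1 \<Gamma>2)
  note fin = finite_rule_instance[OF assms(1) step.hyps(1)]
  obtain f1 f2 where f: "\<And>a. a \<in> \<Pi>1 \<Longrightarrow> finite (f1 a) \<and> finite (f2 a) \<and>
      f1 a \<subseteq> insert a \<Gamma>1 \<and> f2 a \<subseteq> \<Gamma>2 \<and> derives R \<Lambda> \<Psi>1 \<Psi>2 (f1 a) (f2 a)"
    using step.IH(1) by metis
  obtain g1 g2 where g: "\<And>a. a \<in> \<Pi>2 \<Longrightarrow> finite (g1 a) \<and> finite (g2 a) \<and>
      g1 a \<subseteq> \<Gamma>1 \<and> g2 a \<subseteq> insert a \<Gamma>2 \<and> derives R \<Lambda> \<Psi>1 \<Psi>2 (g1 a) (g2 a)"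
    using step.IH(2) by metis
  \<comment> \<open>The formula \<open>a\<close> added for a premise is discharged from that
    premise's support: the rule step puts it back, and what remains lies in the parent pair.\<close>
  define F1 where "F1 = \<Delta>1 \<union> (\<Union>a\<in>\<Pi>1. f1 a - {a}) \<union> (\<Union>a\<in>\<Pi>2. g1 a)"
  define F2 where "F2 = \<Delta>2 \<union> (\<Union>a\<in>\<Pi>1. f2 a) \<union> (\<Union>a\<in>\<Pi>2. g2 a - {a})"
  have "derives R \<Lambda> \<Psi>1 \<Psi>2 F1 F2"
    using step.hyps(1,2)
  proof (rule derives.step)
    show "derives R \<Lambda> \<Psi>1 \<Psi>2 (insert a F1) F2" if "a \<in> \<Pi>1" for a
      by (rule derives_mono[of _ _ _ _ "f1 a" "f2 a"])
        (use f[OF that] that in \<open>auto simp: F1_def F2_def\<close>)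
    show "derives R \<Lambda> \<Psi>1 \<Psi>2 F1 (insert a F2)" if "a \<in> \<Pi>2" for a
      by (rule derives_mono[of _ _ _ _ "g1 a" "g2 a"])
        (use g[OF that] that in \<open>auto simp: F1_def F2_def\<close>)
  qed (auto simp: F1_def F2_def)
  moreover have "F1 \<subseteq> \<Gamma>1" "F2 \<subseteq> \<Gamma>2"
    using f g step.hyps(3,4) unfolding F1_def F2_def by blast+
  moreover have "finite F1" "finite F2"
    using f g fin by (auto simp: F1_def F2_def)
  ultimately show ?case by blast
qed

text \<open>Labels may be infinite, so the whole pair can serve as root; only the branching must be
  finite, and \<open>h_system\<close> provides that. Labels stay inside \<Lambda> because
  \<open>step\<close> adds only formulas from it.\<close>

lemma derives_tree:
  assumes "h_system R" "derives R \<Lambda> \<Psi>1 \<Psi>2 \<Gamma>1 \<Gamma>2" "\<Gamma>1 \<subseteq> \<Lambda>" "\<Gamma>2 \<subseteq> \<Lambda>"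
  shows "\<exists>t. root t = Pair \<Gamma>1 \<Gamma>2 \<and> is_proof R ((\<Gamma>1, \<Gamma>2), (\<Psi>1, \<Psi>2)) t \<and>
    (\<forall>l\<in>labels t. label_formulas l \<subseteq> \<Lambda>)"
  using assms(2-4)
proof induction
  case (hit \<Gamma>1 \<Gamma>2)
  then show ?case
    by (intro exI[of _ "Tree (Pair \<Gamma>1 \<Gamma>2) []"]) (auto intro: derivation.leaf)
next
  case (step \<Delta>1 \<Delta>2 \<Pi>1 \<Pi>2 \<Gamma>1 \<Gamma>2)
  \<comment> \<open>This is \<open>is_proof\<close> together with the bound on labels, but with a
    prescribed root label, so that it also covers a child labelled \<open>Star\<close>.\<close>
  define good where "good l t \<longleftrightarrow> root t = l \<and> derivation R t \<and>
      (\<forall>l\<in>leaf_labels t. l = Star \<or>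
         (\<exists>\<Gamma>1 \<Gamma>2. l = Pair \<Gamma>1 \<Gamma>2 \<and> (\<Gamma>1 \<inter> \<Psi>1 \<noteq> {} \<or> \<Gamma>2 \<inter> \<Psi>2 \<noteq> {}))) \<and>
      (\<forall>l\<in>labels t. label_formulas l \<subseteq> \<Lambda>)" for l t
  note fin = finite_rule_instance[OF assms(1) step.hyps(1)]
  \<comment> \<open>Nonemptiness of \<open>ts\<close> matters because \<open>leaf_labels\<close>
    would count a childless node as a leaf.\<close>
  have "\<exists>ts. child_labels (\<Gamma>1, \<Gamma>2) (\<Pi>1, \<Pi>2) (map root ts) \<and> ts \<noteq> [] \<and> (\<forall>t\<in>set ts. \<exists>l. good l t)"
  proof (cases "\<Pi>1 = {} \<and> \<Pi>2 = {}")
    case True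
    then show ?thesis
      by (intro exI[of _ "[Tree Star []]"])
        (auto simp: child_labels_def good_def intro: derivation.leaf)
  next
    case False
    obtain xs ys where xs: "set xs = \<Pi>1" "distinct xs" and ys: "set ys = \<Pi>2" "distinct ys"
      using finite_distinct_list fin by meson
    have "\<exists>t. good (Pair (insert a \<Gamma>1) \<Gamma>2) t" if "a \<in> \<Pi>1" for a
    proof -
      have "insert a \<Gamma>1 \<subseteq> \<Lambda>" using step.hyps(2) step.prems that by blast
      from step.IH(1)[OF that this step.prems(2)] show ?thesis
        by (auto simp: good_def)
    qed
    then obtain f where f: "\<And>a. a \<in> \<Pi>1 \<Longrightarrow> good (Pair (insert a \<Gamma>1) \<Gamma>2) (f a)" by metis
    have "\<exists>t. good (Pair \<Gamma>1 (insert a \<Gamma>2)) t" if "a \<in> \<Pi>2" for a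
    proof -
      have "insert a \<Gamma>2 \<subseteq> \<Lambda>" using step.hyps(2) step.prems that by blast
      from step.IH(2)[OF that step.prems(1) this] show ?thesis
        by (auto simp: good_def)
    qed
    then obtain g where g: "\<And>a. a \<in> \<Pi>2 \<Longrightarrow> good (Pair \<Gamma>1 (insert a \<Gamma>2)) (g a)" by metis
    have "map root (map f xs @ map g ys) =
        map (\<lambda>a. Pair (insert a \<Gamma>1) \<Gamma>2) xs @ map (\<lambda>a. Pair \<Gamma>1 (insert a \<Gamma>2)) ys"
      using f g xs ys by (auto simp: good_def)
    then have "child_labels (\<Gamma>1, \<Gamma>2) (\<Pi>1, \<Pi>2) (map root (map f xs @ map g ys))"
      unfolding child_labels_def using False xs ys by (metis fst_conv snd_conv)
    moreover have "map f xs @ map g ys \<noteq> []" using False xs ys by auto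
    moreover have "\<forall>t\<in>set (map f xs @ map g ys). \<exists>l. good l t"
      using f g xs ys by auto
    ultimately show ?thesis by blast
  qed
  then obtain ts where ts: "child_labels (\<Gamma>1, \<Gamma>2) (\<Pi>1, \<Pi>2) (map root ts)" "ts \<noteq> []"
    "\<forall>t\<in>set ts. \<exists>l. good l t" by blast
  have "derivation R (Tree (Pair \<Gamma>1 \<Gamma>2) ts)"
    using derivation.expand[OF step.hyps(1,3,4) ts(1)] ts(3) by (auto simp: good_def)
  moreover have "\<forall>l\<in>leaf_labels (Tree (Pair \<Gamma>1 \<Gamma>2) ts). l = Star \<or>
      (\<exists>\<Gamma>1 \<Gamma>2. l = Pair \<Gamma>1 \<Gamma>2 \<and> (\<Gamma>1 \<inter> \<Psi>1 \<noteq> {} \<or> \<Gamma>2 \<inter> \<Psi>2 \<noteq> {}))"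
    using ts(2,3) unfolding good_def leaf_labels.simps set_map if_not_P[OF ts(2)] UN_iff by blast
  moreover have "\<forall>l\<in>labels (Tree (Pair \<Gamma>1 \<Gamma>2) ts). label_formulas l \<subseteq> \<Lambda>"
    using ts(3) step.prems by (auto simp: good_def)
  ultimately show ?case
    by (intro exI[of _ "Tree (Pair \<Gamma>1 \<Gamma>2) ts"]) simp
qed

text \<open>A Lindenbaum-style argument: take a maximal pair from which the succedent is not
  derivable. If it violated an instance inside \<Lambda>, each premise of that instance would add a
  new formula and hence be derivable by maximality, so \<open>step\<close> would derive the
  succedent from the pair itself.\<close>

lemma saturation:
  assumes R: "h_system R" and nd: "\<not> derives R \<Lambda> \<Psi>1 \<Psi>2 \<Phi>1 \<Phi>2"
  obtains G1 G2 where "\<not> obeys G1 G2 ((\<Phi>1, \<Phi>2), (\<Psi>1, \<Psi>2))"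
    and "\<And>r. r \<in> rule_instances R \<Longrightarrow> formulas_of r \<subseteq> \<Lambda> \<Longrightarrow> obeys G1 G2 r"
proof -
  \<comment> \<open>A pair of sets is coded as one subset of the sum type, so that Zorn's lemma for
    inclusion applies to both components at once.\<close>
  define \<A> where "\<A> = {A. \<Phi>1 <+> \<Phi>2 \<subseteq> A \<and> \<not> derives R \<Lambda> \<Psi>1 \<Psi>2 (Inl -` A) (Inr -` A)}"
  have vimage_Plus: "Inl -` (A <+> B) = A" "Inr -` (A <+> B) = B" for A B :: "fm set"
    by auto
  have vimage_insert: "Inl -` insert (Inl a) A = insert a (Inl -` A)"
    "Inr -` insert (Inl a) A = Inr -` A" "Inl -` insert (Inr a) A = Inl -` A"
    "Inr -` insert (Inr a) A = insert a (Inr -` A)" for a and A :: "(fm + fm) set"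
    by auto
  have "\<exists>M\<in>\<A>. \<forall>X\<in>\<A>. M \<subseteq> X \<longrightarrow> X = M"
  proof (rule subset_Zorn_nonempty)
    have "\<Phi>1 <+> \<Phi>2 \<in> \<A>" using nd by (simp add: \<A>_def vimage_Plus)
    then show "\<A> \<noteq> {}" by blast
  next
    fix \<C> assume \<C>: "\<C> \<noteq> {}" "subset.chain \<A> \<C>"
    have "\<not> derives R \<Lambda> \<Psi>1 \<Psi>2 (Inl -` \<Union>\<C>) (Inr -` \<Union>\<C>)"
    proof
      assume "derives R \<Lambda> \<Psi>1 \<Psi>2 (Inl -` \<Union>\<C>) (Inr -` \<Union>\<C>)"
      then obtain F1 F2 where F: "finite F1" "finite F2"
        "F1 \<subseteq> Inl -` \<Union>\<C>" "F2 \<subseteq> Inr -` \<Union>\<C>" "derives R \<Lambda> \<Psi>1 \<Psi>2 F1 F2"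
        by (meson derives_finite[OF R])
      \<comment> \<open>The finite support lies in a single member of the chain, which would then be
        derivable already.\<close>
      have "finite (F1 <+> F2)" "F1 <+> F2 \<subseteq> \<Union>\<C>" using F by auto
      then obtain C where C: "C \<in> \<C>" "F1 <+> F2 \<subseteq> C"
        by (rule finite_subset_Union_chain[OF _ _ \<C>])
      then have "F1 \<subseteq> Inl -` C" "F2 \<subseteq> Inr -` C" by auto
      then have "derives R \<Lambda> \<Psi>1 \<Psi>2 (Inl -` C) (Inr -` C)"
        using F(5) derives_mono by blast
      moreover have "C \<in> \<A>" using C \<C> unfolding subset.chain_def by blast
      ultimately show False by (simp add: \<A>_def)
    qed
    moreover obtain C where "C \<in> \<C>" "C \<in> \<A>"
      using \<C> unfolding subset.chain_def by blast
    then have "\<Phi>1 <+> \<Phi>2 \<subseteq> \<Union>\<C>" unfolding \<A>_def by blast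
    ultimately show "\<Union>\<C> \<in> \<A>" by (simp add: \<A>_def)
  qed
  then obtain M where M: "M \<in> \<A>" and max: "\<And>X. X \<in> \<A> \<Longrightarrow> M \<subseteq> X \<Longrightarrow> X = M" by blast
  define G1 where "G1 = Inl -` M"
  define G2 where "G2 = Inr -` M"
  have \<Phi>: "\<Phi>1 <+> \<Phi>2 \<subseteq> M" and ndM: "\<not> derives R \<Lambda> \<Psi>1 \<Psi>2 G1 G2"
    using M by (auto simp: \<A>_def G1_def G2_def)
  \<comment> \<open>A strictly larger set leaves \<open>\<A>\<close> by maximality; as it still
    contains the root pair, it must have become derivable.\<close>
  have ext1: "derives R \<Lambda> \<Psi>1 \<Psi>2 (insert a G1) G2" if "a \<notin> G1" for a
    using max[of "insert (Inl a) M"] that \<Phi>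
    unfolding \<A>_def G1_def G2_def by (auto simp: vimage_insert)
  have ext2: "derives R \<Lambda> \<Psi>1 \<Psi>2 G1 (insert a G2)" if "a \<notin> G2" for a
    using max[of "insert (Inr a) M"] that \<Phi>
    unfolding \<A>_def G1_def G2_def by (auto simp: vimage_insert)
  show thesis
  proof (rule that)
    have "\<Phi>1 \<subseteq> G1" "\<Phi>2 \<subseteq> G2" using \<Phi> by (auto simp: G1_def G2_def)
    then show "\<not> obeys G1 G2 ((\<Phi>1, \<Phi>2), (\<Psi>1, \<Psi>2))"
      using ndM by (auto intro: derives.hit)
  next
    fix r assume r: "r \<in> rule_instances R" "formulas_of r \<subseteq> \<Lambda>"
    obtain \<Delta>1 \<Delta>2 \<Pi>1 \<Pi>2 where eq: "r = ((\<Delta>1, \<Delta>2), (\<Pi>1, \<Pi>2))" by (metis surj_pair)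
    show "obeys G1 G2 r"
    proof (rule ccontr)
      assume "\<not> obeys G1 G2 r"
      then have *: "\<Delta>1 \<subseteq> G1" "\<Delta>2 \<subseteq> G2" "\<Pi>1 \<inter> G1 = {}" "\<Pi>2 \<inter> G2 = {}"
        by (auto simp: eq)
      have "derives R \<Lambda> \<Psi>1 \<Psi>2 G1 G2"
        using r(1)[unfolded eq]
      proof (rule derives.step)
        show "derives R \<Lambda> \<Psi>1 \<Psi>2 (insert a G1) G2" if "a \<in> \<Pi>1" for a
          using *(3) that by (intro ext1) blast
        show "derives R \<Lambda> \<Psi>1 \<Psi>2 G1 (insert a G2)" if "a \<in> \<Pi>2" for a
          using *(4) that by (intro ext2) blast
      qed (use r(2) * in \<open>auto simp: eq\<close>)
      then show False using ndM by contradiction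
    qed
  qed
qed

section \<open>The calculus for mCi and its soundness\<close>

text \<open>Designation behaves classically for the three binary connectives. The last schema of
  each group says that their values, among \<open>Vf\<close>, \<open>VI\<close>, \<open>Vt\<close>,
  never lie in the second dimension.\<close>

definition conj_rules :: "bstatement set" where
  "conj_rules = {
     (({p, Var 1}, {}), ({Conj p (Var 1)}, {})),
     (({Conj p (Var 1)}, {}), ({p}, {})),
     (({Conj p (Var 1)}, {}), ({Var 1}, {})),
     (({}, {Conj p (Var 1)}), ({}, {}))}"

definition disj_rules :: "bstatement set" where
  "disj_rules = {
     (({p}, {}), ({Disj p (Var 1)}, {})),
     (({Var 1}, {}), ({Disj p (Var 1)}, {})),
     (({Disj p (Var 1)}, {}), ({p, Var 1}, {})),
     (({}, {Disj p (Var 1)}), ({}, {}))}"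

definition imp_rules :: "bstatement set" where
  "imp_rules = {
     (({Var 1}, {}), ({Imp p (Var 1)}, {})),
     (({}, {}), ({p, Imp p (Var 1)}, {})),
     (({p, Imp p (Var 1)}, {}), ({Var 1}, {})),
     (({}, {Imp p (Var 1)}), ({}, {}))}"

text \<open>The first schema records that negating an undesignated value gives a designated one, the
  second that negating \<open>VT\<close> does not. The other two say that negation maps
  {\<open>VF\<close>, \<open>VT\<close>} and its complement into themselves.\<close>

definition neg_rules :: "bstatement set" where
  "neg_rules = {
     (({}, {}), ({p, Neg p}, {})),
     (({p, Neg p}, {p}), ({}, {})),
     (({}, {p}), ({}, {Neg p})),
     (({}, {Neg p}), ({}, {p}))}"

text \<open>Values of \<open>Circ\<close> are always \<open>VF\<close> or \<open>VT\<close>. Exactly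
  for \<open>VI\<close> are a formula and its negation both designated, so the remaining schemas
  make \<open>Circ p\<close> undesignated in that case only.\<close>

definition circ_rules :: "bstatement set" where
  "circ_rules = {
     (({}, {}), ({}, {Circ p})),
     (({Circ p, p, Neg p}, {}), ({}, {})),
     (({}, {}), ({Circ p, p}, {})),
     (({}, {}), ({Circ p, Neg p}, {}))}"

lemmas rule_defs = conj_rules_def disj_rules_def imp_rules_def neg_rules_def circ_rules_def

definition mCi_rules :: "bstatement set" where
  "mCi_rules = conj_rules \<union> disj_rules \<union> imp_rules \<union> neg_rules \<union> circ_rules"

lemma rules_subset:
  "conj_rules \<subseteq> mCi_rules" "disj_rules \<subseteq> mCi_rules" "imp_rules \<subseteq> mCi_rules"
  "neg_rules \<subseteq> mCi_rules" "circ_rules \<subseteq> mCi_rules"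
  by (auto simp: mCi_rules_def)

definition N_mCi :: "val set" where
  "N_mCi = {VF, VT}"

lemma h_system_mCi_rules: "h_system mCi_rules"
  by (auto simp: h_system_def mCi_rules_def rule_defs)

lemma finite_mCi_rules: "finite mCi_rules"
  by (simp add: mCi_rules_def rule_defs)

lemma mCi_rules_sound:
  assumes v: "valuation M_mCi v" and r: "r \<in> rule_instances mCi_rules"
  shows "obeys {a. v a \<in> D_mCi} {a. v a \<in> N_mCi} r"
proof -
  obtain s r' where r': "r' \<in> mCi_rules" "r = subst_statement s r'"
    using r unfolding rule_instances_def by blast
  \<comment> \<open>The schemas mention only \<open>Var 0\<close> and \<open>Var 1\<close>, so the
    substitution matters only through these two images.\<close>
  define a b where "a = s 0" and "b = s 1"
  have ops: "v (Neg a) \<in> neg_mCi (v a)" "v (Circ a) \<in> circ_op M_mCi (v a)"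
    "v (Conj a b) \<in> conj_op M_mCi (v a) (v b)" "v (Disj a b) \<in> disj_op M_mCi (v a) (v b)"
    "v (Imp a b) \<in> imp_op M_mCi (v a) (v b)"
    using v unfolding valuation_def by (simp_all add: M_mCi_def)
  let ?ok = "\<lambda>r. obeys {a. v a \<in> D_mCi} {a. v a \<in> N_mCi} (subst_statement s r)"
  have "\<forall>r\<in>conj_rules. ?ok r"
    using ops(3) by (auto simp: conj_rules_def M_mCi_def D_mCi_def N_mCi_def a_def b_def split: if_splits)
  moreover
  have "\<forall>r\<in>disj_rules. ?ok r"
    using ops(4) by (auto simp: disj_rules_def M_mCi_def D_mCi_def N_mCi_def a_def b_def split: if_splits)
  moreover
  have "\<forall>r\<in>imp_rules. ?ok r"
    using ops(5) by (auto simp: imp_rules_def M_mCi_def D_mCi_def N_mCi_def a_def b_def split: if_splits)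
  moreover
  have "\<forall>r\<in>neg_rules. ?ok r"
    using ops(1) by (cases "v a") (auto simp: neg_rules_def D_mCi_def N_mCi_def a_def)
  moreover
  have "\<forall>r\<in>circ_rules. ?ok r"
    using ops(1,2)
    by (cases "v a") (auto simp: circ_rules_def M_mCi_def D_mCi_def N_mCi_def a_def)
  ultimately show ?thesis using r' unfolding mCi_rules_def by blast
qed

section \<open>From saturated pairs to countermodels\<close>

definition val_of :: "fm set \<Rightarrow> fm set \<Rightarrow> fm \<Rightarrow> val" where
  "val_of G1 G2 a =
     (if a \<in> G1 then if a \<in> G2 then VT else if Neg a \<in> G1 then VI else Vt
      else if a \<in> G2 then VF else Vf)"

lemma val_of_designated: "val_of G1 G2 a \<in> D_mCi \<longleftrightarrow> a \<in> G1"
  and val_of_N: "val_of G1 G2 a \<in> N_mCi \<longleftrightarrow> a \<in> G2"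
  by (auto simp: val_of_def D_mCi_def N_mCi_def)

text \<open>Every entry of the multi-operations is nonempty, so outside of \<open>X\<close> any choice will do.\<close>

primrec extend :: "fm set \<Rightarrow> (fm \<Rightarrow> val) \<Rightarrow> fm \<Rightarrow> val" where
  "extend X u (Var n) = u (Var n)"
| "extend X u (Neg a) = (if Neg a \<in> X then u (Neg a)
     else SOME x. x \<in> neg_op M_mCi (extend X u a))"
| "extend X u (Circ a) = (if Circ a \<in> X then u (Circ a)
     else SOME x. x \<in> circ_op M_mCi (extend X u a))"
| "extend X u (Conj a b) = (if Conj a b \<in> X then u (Conj a b)
     else SOME x. x \<in> conj_op M_mCi (extend X u a) (extend X u b))"
| "extend X u (Disj a b) = (if Disj a b \<in> X then u (Disj a b)
     else SOME x. x \<in> disj_op M_mCi (extend X u a) (extend X u b))"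
| "extend X u (Imp a b) = (if Imp a b \<in> X then u (Imp a b)
     else SOME x. x \<in> imp_op M_mCi (extend X u a) (extend X u b))"

lemma extend_eq: "a \<in> X \<Longrightarrow> extend X u a = u a"
  by (cases a) auto

lemma M_mCi_total:
  "neg_op M_mCi x \<noteq> {}" "circ_op M_mCi x \<noteq> {}" "conj_op M_mCi x y \<noteq> {}"
  "disj_op M_mCi x y \<noteq> {}" "imp_op M_mCi x y \<noteq> {}"
  by (cases x; simp add: M_mCi_def)+

text \<open>A compound formula in \<open>X\<close> has its components in \<open>X\<close>, where
  \<open>extend\<close> agrees with \<open>u\<close>; one outside \<open>X\<close> receives a choice
  from a nonempty entry computed from \<open>extend\<close> itself.\<close>

lemma valuation_extend:
  assumes "\<And>a. Neg a \<in> X \<Longrightarrow> a \<in> X \<and> u (Neg a) \<in> neg_op M_mCi (u a)"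
    and "\<And>a. Circ a \<in> X \<Longrightarrow> a \<in> X \<and> u (Circ a) \<in> circ_op M_mCi (u a)"
    and "\<And>a b. Conj a b \<in> X \<Longrightarrow> a \<in> X \<and> b \<in> X \<and> u (Conj a b) \<in> conj_op M_mCi (u a) (u b)"
    and "\<And>a b. Disj a b \<in> X \<Longrightarrow> a \<in> X \<and> b \<in> X \<and> u (Disj a b) \<in> disj_op M_mCi (u a) (u b)"
    and "\<And>a b. Imp a b \<in> X \<Longrightarrow> a \<in> X \<and> b \<in> X \<and> u (Imp a b) \<in> imp_op M_mCi (u a) (u b)"
  shows "valuation M_mCi (extend X u)"
  unfolding valuation_def
proof (intro conjI allI)
  show "extend X u (Neg a) \<in> neg_op M_mCi (extend X u a)" for a
    using assms(1)[of a] by (auto simp: extend_eq some_in_eq M_mCi_total)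
  show "extend X u (Circ a) \<in> circ_op M_mCi (extend X u a)" for a
    using assms(2)[of a] by (auto simp: extend_eq some_in_eq M_mCi_total)
  show "extend X u (Conj a b) \<in> conj_op M_mCi (extend X u a) (extend X u b)" for a b
    using assms(3)[of a b] by (auto simp: extend_eq some_in_eq M_mCi_total)
  show "extend X u (Disj a b) \<in> disj_op M_mCi (extend X u a) (extend X u b)" for a b
    using assms(4)[of a b] by (auto simp: extend_eq some_in_eq M_mCi_total)
  show "extend X u (Imp a b) \<in> imp_op M_mCi (extend X u a) (extend X u b)" for a b
    using assms(5)[of a b] by (auto simp: extend_eq some_in_eq M_mCi_total)
qed

lemma subformulas_self: "a \<in> subformulas a"
  by (cases a) auto

lemma subformulas_trans: "b \<in> subformulas a \<Longrightarrow> subformulas b \<subseteq> subformulas a"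
  by (induction a) auto

lemma gen_subformulas_Neg:
  "gen_subformulas {p, Neg p} \<Xi> =
     (\<Union>a\<in>\<Xi>. subformulas a) \<union> Neg ` (\<Union>a\<in>\<Xi>. subformulas a)" (is "?L = ?X \<union> Neg ` ?X")
proof
  show "?L \<subseteq> ?X \<union> Neg ` ?X"
    unfolding gen_subformulas_def by auto
  show "?X \<union> Neg ` ?X \<subseteq> ?L"
  proof
    fix c assume "c \<in> ?X \<union> Neg ` ?X"
    \<comment> \<open>Generalized subformulas require every variable to be sent into
      \<open>?X\<close>, hence the constant substitution.\<close>
    then obtain a \<theta> where "a \<in> ?X" "\<theta> \<in> {p, Neg p}" "c = subst (\<lambda>_. a) \<theta>" by fastforce
    then show "c \<in> ?L"
      unfolding gen_subformulas_def by blast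
  qed
qed

text \<open>The schemas for binary connectives mention no negation, so all their instances at
  \<open>a\<close> and \<open>b\<close> already live among these two formulas and the
  compound.\<close>

lemma conj_rules_obeyed:
  assumes "\<forall>r\<in>conj_rules. formulas_of (subst_statement (\<lambda>n. if n = 0 then a else b) r) \<subseteq> \<Lambda> \<longrightarrow>
      obeys G1 G2 (subst_statement (\<lambda>n. if n = 0 then a else b) r)"
    and "a \<in> \<Lambda>" "b \<in> \<Lambda>" "Conj a b \<in> \<Lambda>"
  shows "Conj a b \<notin> G2 \<and> (Conj a b \<in> G1 \<longleftrightarrow> a \<in> G1 \<and> b \<in> G1)"
  using assms unfolding conj_rules_def by (simp (no_asm_use)) blast

lemma disj_rules_obeyed:
  assumes "\<forall>r\<in>disj_rules. formulas_of (subst_statement (\<lambda>n. if n = 0 then a else b) r) \<subseteq> \<Lambda> \<longrightarrow>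
      obeys G1 G2 (subst_statement (\<lambda>n. if n = 0 then a else b) r)"
    and "a \<in> \<Lambda>" "b \<in> \<Lambda>" "Disj a b \<in> \<Lambda>"
  shows "Disj a b \<notin> G2 \<and> (Disj a b \<in> G1 \<longleftrightarrow> a \<in> G1 \<or> b \<in> G1)"
  using assms by (auto simp: disj_rules_def)

text \<open>Both arrows have the same priority and associate to the right, so the right-hand side of
  the equivalence is the whole implication.\<close>

lemma imp_rules_obeyed:
  assumes "\<forall>r\<in>imp_rules. formulas_of (subst_statement (\<lambda>n. if n = 0 then a else b) r) \<subseteq> \<Lambda> \<longrightarrow>
      obeys G1 G2 (subst_statement (\<lambda>n. if n = 0 then a else b) r)"
    and "a \<in> \<Lambda>" "b \<in> \<Lambda>" "Imp a b \<in> \<Lambda>"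
  shows "Imp a b \<notin> G2 \<and> (Imp a b \<in> G1 \<longleftrightarrow> a \<in> G1 \<longrightarrow> b \<in> G1)"
  using assms by (auto simp: imp_rules_def)

text \<open>A saturated pair assigns values through \<open>val_of\<close>; its closure under
  instances within \<Lambda> makes these respect the tables on all subformulas of the statement, and
  \<open>extend\<close> then completes them to a valuation.\<close>

lemma mCi_countermodel:
  assumes nd: "\<not> derives mCi_rules (gen_subformulas {p, Neg p} (formulas_of S)) \<Psi>1 \<Psi>2 \<Phi>1 \<Phi>2"
    and S: "S = ((\<Phi>1, \<Phi>2), (\<Psi>1, \<Psi>2))"
  obtains v where "valuation M_mCi v" "\<not> obeys {a. v a \<in> D_mCi} {a. v a \<in> N_mCi} S"
proof -
  define X where "X = (\<Union>a\<in>formulas_of S. subformulas a)"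
  define \<Lambda> where "\<Lambda> = X \<union> Neg ` X"
  have "\<not> derives mCi_rules \<Lambda> \<Psi>1 \<Psi>2 \<Phi>1 \<Phi>2"
    using nd by (simp add: \<Lambda>_def X_def gen_subformulas_Neg)
  then obtain G1 G2 where notS: "\<not> obeys G1 G2 S"
    and closed: "\<And>r. r \<in> rule_instances mCi_rules \<Longrightarrow> formulas_of r \<subseteq> \<Lambda> \<Longrightarrow> obeys G1 G2 r"
    using saturation[OF h_system_mCi_rules] unfolding S by blast
  have rules: "\<forall>r\<in>R. formulas_of (subst_statement (\<lambda>n. if n = 0 then a else b) r) \<subseteq> \<Lambda> \<longrightarrow>
      obeys G1 G2 (subst_statement (\<lambda>n. if n = 0 then a else b) r)" if "R \<subseteq> mCi_rules" for R a b
    using closed that unfolding rule_instances_def by blast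
  have \<Lambda>: "a \<in> \<Lambda>" "Neg a \<in> \<Lambda>" if "a \<in> X" for a
    using that by (auto simp: \<Lambda>_def)
  have sub: "subformulas a \<subseteq> X" if "a \<in> X" for a
    using that subformulas_trans unfolding X_def by blast
  define u where "u = val_of G1 G2"
  have "valuation M_mCi (extend X u)"
  proof (rule valuation_extend)
    fix a assume X: "Neg a \<in> X"
    then have a: "a \<in> X" using sub[OF X] subformulas_self[of a] by auto
    have neg: "Neg a \<in> G2 \<longleftrightarrow> a \<in> G2" "a \<in> G1 \<or> Neg a \<in> G1" "\<not> (a \<in> G1 \<and> a \<in> G2 \<and> Neg a \<in> G1)"
      using rules[OF rules_subset(4), of a a] \<Lambda>[OF a] by (auto simp: neg_rules_def)
    \<comment> \<open>\<open>Neg (Neg a)\<close> only decides between \<open>VI\<close> and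
      \<open>Vt\<close> for a designated \<open>Neg a\<close> outside \<open>G2\<close>, and the
      table then allows both.\<close>
    have "u (Neg a) \<in> neg_op M_mCi (u a)"
      using neg by (auto simp: u_def val_of_def M_mCi_def)
    with a show "a \<in> X \<and> u (Neg a) \<in> neg_op M_mCi (u a)" ..
  next
    fix a assume X: "Circ a \<in> X"
    then have a: "a \<in> X" using sub[OF X] subformulas_self[of a] by auto
    \<comment> \<open>Here \<open>Neg a\<close> need not be a subformula of the statement, only a
      member of \<Lambda>. The fact excludes \<open>VT\<close> for \<open>a\<close> when
      \<open>Circ a\<close> is undesignated.\<close>
    have neg: "\<not> (a \<in> G1 \<and> a \<in> G2 \<and> Neg a \<in> G1)"
      using rules[OF rules_subset(4), of a a] \<Lambda>[OF a] by (auto simp: neg_rules_def)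
    have circ: "Circ a \<in> G2" "Circ a \<in> G1 \<longleftrightarrow> \<not> (a \<in> G1 \<and> Neg a \<in> G1)"
      using rules[OF rules_subset(5), of a a] \<Lambda>[OF a] \<Lambda>[OF X] by (auto simp: circ_rules_def)
    have "u (Circ a) \<in> circ_op M_mCi (u a)"
      using neg circ by (auto simp: u_def val_of_def M_mCi_def)
    with a show "a \<in> X \<and> u (Circ a) \<in> circ_op M_mCi (u a)" ..
  next
    fix a b assume X: "Conj a b \<in> X"
    then have a: "a \<in> X" "b \<in> X" using sub[OF X] subformulas_self[of a] subformulas_self[of b] by auto
    have "Conj a b \<notin> G2 \<and> (Conj a b \<in> G1 \<longleftrightarrow> a \<in> G1 \<and> b \<in> G1)"
      by (rule conj_rules_obeyed[OF rules[OF rules_subset(1)] \<Lambda>(1)[OF a(1)] \<Lambda>(1)[OF a(2)] \<Lambda>(1)[OF X]])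
    \<comment> \<open>Outside \<open>G2\<close> an undesignated formula has value \<open>Vf\<close>
      and a designated one \<open>VI\<close> or \<open>Vt\<close>, which are exactly the two
      possible entries of the table.\<close>
    then have "u (Conj a b) \<in> conj_op M_mCi (u a) (u b)"
      by (auto simp: u_def M_mCi_def val_of_designated) (auto simp: val_of_def split: if_splits)
    with a show "a \<in> X \<and> b \<in> X \<and> u (Conj a b) \<in> conj_op M_mCi (u a) (u b)" by blast
  next
    fix a b assume X: "Disj a b \<in> X"
    then have a: "a \<in> X" "b \<in> X" using sub[OF X] subformulas_self[of a] subformulas_self[of b] by auto
    have "Disj a b \<notin> G2 \<and> (Disj a b \<in> G1 \<longleftrightarrow> a \<in> G1 \<or> b \<in> G1)"
      by (rule disj_rules_obeyed[OF rules[OF rules_subset(2)] \<Lambda>(1)[OF a(1)] \<Lambda>(1)[OF a(2)] \<Lambda>(1)[OF X]])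
    then have "u (Disj a b) \<in> disj_op M_mCi (u a) (u b)"
      by (auto simp: u_def M_mCi_def val_of_designated) (auto simp: val_of_def split: if_splits)
    with a show "a \<in> X \<and> b \<in> X \<and> u (Disj a b) \<in> disj_op M_mCi (u a) (u b)" by blast
  next
    fix a b assume X: "Imp a b \<in> X"
    then have a: "a \<in> X" "b \<in> X" using sub[OF X] subformulas_self[of a] subformulas_self[of b] by auto
    have "Imp a b \<notin> G2 \<and> (Imp a b \<in> G1 \<longleftrightarrow> (a \<in> G1 \<longrightarrow> b \<in> G1))"
      by (rule imp_rules_obeyed[OF rules[OF rules_subset(3)] \<Lambda>(1)[OF a(1)] \<Lambda>(1)[OF a(2)] \<Lambda>(1)[OF X]])
    then have "u (Imp a b) \<in> imp_op M_mCi (u a) (u b)"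
      by (auto simp: u_def M_mCi_def val_of_designated) (auto simp: val_of_def split: if_splits)
    with a show "a \<in> X \<and> b \<in> X \<and> u (Imp a b) \<in> imp_op M_mCi (u a) (u b)" by blast
  qed
  moreover have "extend X u a \<in> D_mCi \<longleftrightarrow> a \<in> G1" "extend X u a \<in> N_mCi \<longleftrightarrow> a \<in> G2"
    if "a \<in> formulas_of S" for a
  proof -
    have "a \<in> X" using that subformulas_self unfolding X_def by blast
    then show "extend X u a \<in> D_mCi \<longleftrightarrow> a \<in> G1" "extend X u a \<in> N_mCi \<longleftrightarrow> a \<in> G2"
      by (simp_all add: extend_eq u_def val_of_designated val_of_N)
  qed
  then have "\<not> obeys {a. extend X u a \<in> D_mCi} {a. extend X u a \<in> N_mCi} S"
    using notS unfolding S by auto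
  ultimately show thesis using that by blast
qed

section \<open>Completeness, analyticity and the one-dimensional aspect\<close>

text \<open>One tree serves for both completeness and analyticity, since the countermodel is built
  from underivability within the generalized subformulas alone.\<close>

lemma mCi_rules_complete:
  assumes "\<And>v. valuation M_mCi v \<Longrightarrow> obeys {a. v a \<in> D_mCi} {a. v a \<in> N_mCi} S"
  shows "\<exists>t. is_proof mCi_rules S t \<and>
    (\<forall>l\<in>labels t. label_formulas l \<subseteq> gen_subformulas {p, Neg p} (formulas_of S))"
proof -
  obtain \<Phi>1 \<Phi>2 \<Psi>1 \<Psi>2 where S: "S = ((\<Phi>1, \<Phi>2), (\<Psi>1, \<Psi>2))" by (metis surj_pair)
  let ?\<Lambda> = "gen_subformulas {p, Neg p} (formulas_of S)"
  have "derives mCi_rules ?\<Lambda> \<Psi>1 \<Psi>2 \<Phi>1 \<Phi>2"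
    using mCi_countermodel[OF _ S] assms by blast
  moreover have "formulas_of S \<subseteq> ?\<Lambda>"
    using subformulas_self unfolding gen_subformulas_Neg by blast
  then have "\<Phi>1 \<subseteq> ?\<Lambda>" "\<Phi>2 \<subseteq> ?\<Lambda>" by (simp_all add: S)
  ultimately have "\<exists>t. root t = Pair \<Phi>1 \<Phi>2 \<and> is_proof mCi_rules S t \<and>
      (\<forall>l\<in>labels t. label_formulas l \<subseteq> ?\<Lambda>)"
    unfolding S by (rule derives_tree[OF h_system_mCi_rules])
  then show ?thesis by blast
qed

lemma provable_mCi_rules_iff:
  "provable mCi_rules S \<longleftrightarrow>
     (\<forall>v. valuation M_mCi v \<longrightarrow> obeys {a. v a \<in> D_mCi} {a. v a \<in> N_mCi} S)"
proof
  show "\<forall>v. valuation M_mCi v \<longrightarrow> obeys {a. v a \<in> D_mCi} {a. v a \<in> N_mCi} S"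
    if "provable mCi_rules S"
    by (intro allI impI) (rule provable_sound[OF that mCi_rules_sound])
  show "provable mCi_rules S"
    if "\<forall>v. valuation M_mCi v \<longrightarrow> obeys {a. v a \<in> D_mCi} {a. v a \<in> N_mCi} S"
    using mCi_rules_complete[of S] that unfolding provable_def by fast
qed

theorem theorem5:
  "\<exists>R \<Theta>. h_system R \<and> finite R \<and>
     finite \<Theta> \<and> {p} \<subseteq> \<Theta> \<and> (\<forall>\<theta>\<in>\<Theta>. vars \<theta> = vars p) \<and>
     analytic \<Theta> R \<and>
     (\<forall>\<Phi> \<Psi>. t_aspect R \<Phi> \<Psi> \<longleftrightarrow> entails M_mCi \<Phi> \<Psi>)"
proof (intro exI conjI)
  show "h_system mCi_rules" "finite mCi_rules"
    by (fact h_system_mCi_rules finite_mCi_rules)+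
  show "finite {p, Neg p}" "{p} \<subseteq> {p, Neg p}" "\<forall>\<theta>\<in>{p, Neg p}. vars \<theta> = vars p"
    by auto
  \<comment> \<open>Analyticity goes through the semantics: a provable statement is valid by
    soundness, and completeness then returns a proof with bounded labels.\<close>
  show "analytic {p, Neg p} mCi_rules"
    unfolding analytic_def using provable_mCi_rules_iff mCi_rules_complete by simp
  show "\<forall>\<Phi> \<Psi>. t_aspect mCi_rules \<Phi> \<Psi> \<longleftrightarrow> entails M_mCi \<Phi> \<Psi>"
  proof (intro allI)
    fix \<Phi> \<Psi>
    \<comment> \<open>With empty second components, validity of the statement refers to designation
      only and becomes entailment.\<close>
    have "designated M_mCi = D_mCi" by (simp add: M_mCi_def)
    then show "t_aspect mCi_rules \<Phi> \<Psi> \<longleftrightarrow> entails M_mCi \<Phi> \<Psi>"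
      unfolding t_aspect_def provable_mCi_rules_iff entails_def by auto
  qed
qed

end
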